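(* Let $F=f+\Psi$, where $f:\mathbb{R}^N\to\mathbb{R}$ is smooth and convex and $\Psi$ is a block-separable closed convex function. Let $S_0,S_1,\dots$ be independent identically distributed proper uniform samplings satisfying $(f,S_0)\sim ESO(\beta,w)$, and assume that $F$ is strongly convex with respect to the norm $\|\cdot\|_w$, i.e. $\mu_F(w)>0$. Choose an initial point $x_0\in\operatorname{dom}F$, a target confidence level $\rho\in(0,1)$, a target accuracy level $0<\epsilon<F(x_0)-F^*$, and an iteration counter $$K\ \ge\ \frac{n}{\mathbf{E}[|S_0|]}\,\frac{\beta+\mu_F(w)-\mu_f(w)}{\mu_F(w)}\,\log\left(\frac{F(x_0)-F^*}{\epsilon\rho}\right).$$ If $\{x_k\}_{k\ge0}$ are the random points generated by PCDM (the parallel coordinate descent method described in the context) applied to $\min_{x\in\mathbb{R}^N}F(x)$, then $$\mathbf{P}(F(x_K)-F^*\le\epsilon)\ge1-\rho.$$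
   Context: Blocks: $N=\sum_{i=1}^nN_i$; $I=[U_1,\dots,U_n]$ is the columnwise partition of the $N\times N$ identity with $U_i\in\mathbb{R}^{N\times N_i}$, and $x^{(i)}=U_i^Tx$. $\Psi(x)=\sum_{i=1}^n\Psi_i(x^{(i)})$ with $\Psi_i:\mathbb{R}^{N_i}\to\mathbb{R}\cup\{+\infty\}$ convex and closed. $F^*=\min_{x\in\mathbb{R}^N}F(x)$. Norm: for each $i$ a positive definite $B_i\in\mathbb{R}^{N_i\times N_i}$ is fixed, $\|t\|_{(i)}=\langle B_it,t\rangle^{1/2}$, and for positive weights $w=(w_1,\dots,w_n)$, $\|x\|_w=\left(\sum_{i=1}^nw_i\|x^{(i)}\|_{(i)}^2\right)^{1/2}$. Strong convexity: $\phi:\mathbb{R}^N\to\mathbb{R}\cup\{+\infty\}$ is strongly convex with respect to $\|\cdot\|_w$ with convexity parameter $\mu_\phi(w)\ge0$ if for all $x,y\in\operatorname{dom}\phi$ and any subgradient $\phi'(x)$ of $\phi$ at $x$, $\phi(y)\ge\phi(x)+\langle\phi'(x),y-x\rangle+\frac{\mu_\phi(w)}2\|y-x\|_w^2$. The value $\mu_\phi(w)=0$ corresponds to plain convexity. $\mu_F(w)$ and $\mu_f(w)$ are such parameters for $F$ and $f$. Samplings: a sampling is a random subset $\hat S$ of $\{1,\dots,n\}$. It is uniform if $\mathbf{P}(i\in\hat S)=\mathbf{P}(j\in\hat S)$ for all $i,j$, and proper if $\mathbf{P}(i\in\hat S)>0$ for all $i$. ESO: for positive constants $\beta,w_1,\dots,w_n$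 and a proper uniform sampling $\hat S$, $(f,\hat S)\sim ESO(\beta,w)$ means that for all $x,h\in\mathbb{R}^N$, $$\mathbf{E}\Big[f\Big(x+\sum_{i\in\hat S}U_ih^{(i)}\Big)\Big]\le f(x)+\frac{\mathbf{E}[|\hat S|]}n\Big(\langle f'(x),h\rangle+\frac\beta2\|h\|_w^2\Big).$$ PCDM: given $x_0$ and ESO parameters $(\beta,w)$, for $k=0,1,2,\dots$ compute $$h_k=\arg\min_{h\in\mathbb{R}^N}\Big\{f(x_k)+\langle f'(x_k),h\rangle+\tfrac\beta2\|h\|_w^2+\Psi(x_k+h)\Big\},\qquad x_{k+1}=x_k+\sum_{i\in S_k}U_ih_k^{(i)}.$$ *)

theory Defs
  imports "HOL-Probability.Probability"
begin

text \<open>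
  The coordinates of \<open>\<real>\<^sup>N\<close> form the finite type \<open>'m\<close>, the blocks the finite type \<open>'b\<close> (so
  \<open>n = CARD('b)\<close>), and \<open>blk c\<close> is the block of coordinate \<open>c\<close>: the columns of \<open>U\<^sub>i\<close> are the
  standard basis vectors with index in \<open>blk -` {i}\<close>. Since the dimension \<open>N\<^sub>i\<close> varies with \<open>i\<close>,
  a block vector \<open>t \<in> \<real>^N\<^sub>i\<close> is represented by its zero-padded copy \<open>U\<^sub>i t \<in> block_space blk i\<close>. Under this
  identification \<open>block blk i x\<close> is both the block \<open>x\<^sup>(\<^sup>i\<^sup>) = U\<^sub>i\<^sup>T x\<close> and \<open>U\<^sub>i x\<^sup>(\<^sup>i\<^sup>)\<close>.
\<close>

definition block_space :: "('m \<Rightarrow> 'b) \<Rightarrow> 'b \<Rightarrow> (real ^ 'm) set" where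
  "block_space blk i = {t. \<forall>c. blk c \<noteq> i \<longrightarrow> t $ c = 0}"

definition block :: "('m \<Rightarrow> 'b) \<Rightarrow> 'b \<Rightarrow> real ^ 'm \<Rightarrow> real ^ 'm" where
  "block blk i x = (\<chi> c. if blk c = i then x $ c else 0)"

text \<open>
  Only the entries of \<open>B\<close> with both indices in block \<open>i\<close> matter, here and in \<open>norm_w\<close>; they form the
  \<open>N\<^sub>i \<times> N\<^sub>i\<close> matrix.
\<close>

definition posdef_block :: "('m::finite \<Rightarrow> 'b) \<Rightarrow> 'b \<Rightarrow> real ^ 'm ^ 'm \<Rightarrow> bool" where
  "posdef_block blk i B \<longleftrightarrow>
     (\<forall>c d. blk c = i \<longrightarrow> blk d = i \<longrightarrow> B $ c $ d = B $ d $ c) \<and>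
     (\<forall>t \<in> block_space blk i. t \<noteq> 0 \<longrightarrow> 0 < (B *v t) \<bullet> t)"

definition block_norm :: "real ^ 'm::finite ^ 'm \<Rightarrow> real ^ 'm \<Rightarrow> real" where
  "block_norm B t = sqrt ((B *v t) \<bullet> t)"

definition norm_w ::
  "('m::finite \<Rightarrow> 'b::finite) \<Rightarrow> ('b \<Rightarrow> real ^ 'm ^ 'm) \<Rightarrow> ('b \<Rightarrow> real) \<Rightarrow> real ^ 'm \<Rightarrow> real" where
  "norm_w blk B w x = sqrt (\<Sum>i\<in>UNIV. w i * (block_norm (B i) (block blk i x))\<^sup>2)"

definition edom :: "('a \<Rightarrow> ereal) \<Rightarrow> 'a set" where
  "edom \<phi> = {x. \<phi> x < \<infinity>}"

definition closed_convex_on :: "'a::real_normed_vector set \<Rightarrow> ('a \<Rightarrow> ereal) \<Rightarrow> bool" where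
  "closed_convex_on D \<phi> \<longleftrightarrow>
     (\<forall>t\<in>D. \<phi> t \<noteq> -\<infinity>) \<and>
     convex {(t, r::real). t \<in> D \<and> \<phi> t \<le> ereal r} \<and>
     closed {(t, r::real). t \<in> D \<and> \<phi> t \<le> ereal r}"

definition block_sep ::
  "('m \<Rightarrow> 'b::finite) \<Rightarrow> ('b \<Rightarrow> real ^ 'm \<Rightarrow> ereal) \<Rightarrow> real ^ 'm \<Rightarrow> ereal" where
  "block_sep blk \<psi> x = (\<Sum>i\<in>UNIV. \<psi> i (block blk i x))"

definition is_subgradient :: "('a::real_inner \<Rightarrow> ereal) \<Rightarrow> 'a \<Rightarrow> 'a \<Rightarrow> bool" where
  "is_subgradient \<phi> x g \<longleftrightarrow> (\<forall>y. \<phi> x + ereal (g \<bullet> (y - x)) \<le> \<phi> y)"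

definition convexity_param ::
  "('a::real_inner \<Rightarrow> real) \<Rightarrow> ('a \<Rightarrow> ereal) \<Rightarrow> real \<Rightarrow> bool" where
  "convexity_param nrm \<phi> \<mu> \<longleftrightarrow> 0 \<le> \<mu> \<and>
     (\<forall>x \<in> edom \<phi>. \<forall>y \<in> edom \<phi>. \<forall>g. is_subgradient \<phi> x g \<longrightarrow>
        \<phi> x + ereal (g \<bullet> (y - x)) + ereal (\<mu> / 2 * (nrm (y - x))\<^sup>2) \<le> \<phi> y)"

definition sampling :: "'a measure \<Rightarrow> ('a \<Rightarrow> 'b::finite set) \<Rightarrow> bool" where
  "sampling M S \<longleftrightarrow> S \<in> measurable M (count_space UNIV)"

definition uniform_sampling :: "'a measure \<Rightarrow> ('a \<Rightarrow> 'b::finite set) \<Rightarrow> bool" where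
  "uniform_sampling M S \<longleftrightarrow> sampling M S \<and>
     (\<forall>i j. measure M {\<omega> \<in> space M. i \<in> S \<omega>} = measure M {\<omega> \<in> space M. j \<in> S \<omega>})"

definition proper_sampling :: "'a measure \<Rightarrow> ('a \<Rightarrow> 'b::finite set) \<Rightarrow> bool" where
  "proper_sampling M S \<longleftrightarrow> sampling M S \<and> (\<forall>i. 0 < measure M {\<omega> \<in> space M. i \<in> S \<omega>})"

definition mean_card :: "'a measure \<Rightarrow> ('a \<Rightarrow> 'b::finite set) \<Rightarrow> real" where
  "mean_card M S = (LINT \<omega>|M. real (card (S \<omega>)))"

definition ESO ::
  "('m::finite \<Rightarrow> 'b::finite) \<Rightarrow> ('b \<Rightarrow> real ^ 'm ^ 'm) \<Rightarrow> (real ^ 'm \<Rightarrow> real) \<Rightarrow>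
   (real ^ 'm \<Rightarrow> real ^ 'm) \<Rightarrow> 'a measure \<Rightarrow> ('a \<Rightarrow> 'b set) \<Rightarrow> real \<Rightarrow> ('b \<Rightarrow> real) \<Rightarrow> bool" where
  "ESO blk B f f' M S \<beta> w \<longleftrightarrow>
     (\<forall>x h. (LINT \<omega>|M. f (x + (\<Sum>i\<in>S \<omega>. block blk i h)))
        \<le> f x + mean_card M S / real CARD('b) *
             (f' x \<bullet> h + \<beta> / 2 * (norm_w blk B w h)\<^sup>2))"

definition pcdm_model ::
  "('m::finite \<Rightarrow> 'b::finite) \<Rightarrow> ('b \<Rightarrow> real ^ 'm ^ 'm) \<Rightarrow> (real ^ 'm \<Rightarrow> real) \<Rightarrow>
   (real ^ 'm \<Rightarrow> real ^ 'm) \<Rightarrow> (real ^ 'm \<Rightarrow> ereal) \<Rightarrow> real \<Rightarrow> ('b \<Rightarrow> real) \<Rightarrow>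
   real ^ 'm \<Rightarrow> real ^ 'm \<Rightarrow> ereal" where
  "pcdm_model blk B f f' \<Psi> \<beta> w x h =
     ereal (f x + f' x \<bullet> h + \<beta> / 2 * (norm_w blk B w h)\<^sup>2) + \<Psi> (x + h)"

text \<open>One run of the method for a fixed realization \<open>s 0, s 1, \<dots>\<close> of the samplings.\<close>

definition pcdm_run ::
  "('m::finite \<Rightarrow> 'b::finite) \<Rightarrow> ('b \<Rightarrow> real ^ 'm ^ 'm) \<Rightarrow> (real ^ 'm \<Rightarrow> real) \<Rightarrow>
   (real ^ 'm \<Rightarrow> real ^ 'm) \<Rightarrow> (real ^ 'm \<Rightarrow> ereal) \<Rightarrow> real \<Rightarrow> ('b \<Rightarrow> real) \<Rightarrow>
   (nat \<Rightarrow> 'b set) \<Rightarrow> real ^ 'm \<Rightarrow> (nat \<Rightarrow> real ^ 'm) \<Rightarrow> bool" where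
  "pcdm_run blk B f f' \<Psi> \<beta> w s x0 x \<longleftrightarrow>
     x 0 = x0 \<and>
     (\<forall>k. \<exists>h. is_arg_min (pcdm_model blk B f f' \<Psi> \<beta> w (x k)) (\<lambda>_. True) h \<and>
              x (Suc k) = x k + (\<Sum>i\<in>s k. block blk i h))"

end

theory Submission
  imports Defs
begin

text \<open>
  One step of the method contracts the expected gap \<open>F x - F\<^sup>*\<close> by the factor
  \<open>1 - \<alpha> \<lambda>\<close>, where \<open>\<alpha> = E |S| / n\<close> and \<open>\<lambda> = \<mu>\<^sub>F / (\<beta> + \<mu>\<^sub>F - \<mu>\<^sub>f) \<in> (0, 1]\<close>. ESO and separability of
  \<open>\<Psi>\<close> bound the expected new value by \<open>(1 - \<alpha>) F(x) + \<alpha> H(x)\<close>, where \<open>H(x)\<close> is the minimum of the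
  model; taking the step \<open>\<lambda> (x\<^sup>* - x)\<close> in the model and using strong convexity of \<open>f\<close> and of \<open>F\<close>
  gives \<open>H(x) - F\<^sup>* \<le> (1 - \<lambda>) (F(x) - F\<^sup>*)\<close>. By independence the contraction iterates, and Markov's
  inequality turns \<open>(1 - \<alpha> \<lambda>)\<^sup>K \<le> exp (- \<alpha> \<lambda> K)\<close> into the claim.
\<close>

subsection \<open>Closed convex functions and strong convexity\<close>

text \<open>The complement is the section of the closed epigraph at height \<open>b\<close>. This is
  lower semicontinuity, the form in which closedness is used in the limit arguments.\<close>

lemma closed_convex_on_superlevel_open:
  assumes "closed_convex_on UNIV \<phi>"
  shows "open {y. ereal b < \<phi> y}"
proof -
  have "closed ((\<lambda>y. (y, b)) -` {(t, r). t \<in> UNIV \<and> \<phi> t \<le> ereal r})"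
    using assms by (intro closed_vimage continuous_intros) (simp add: closed_convex_on_def)
  then have "open (- ((\<lambda>y. (y, b)) -` {(t, r). t \<in> UNIV \<and> \<phi> t \<le> ereal r}))"
    by (simp add: closed_def)
  also have "- ((\<lambda>y. (y, b)) -` {(t, r). t \<in> UNIV \<and> \<phi> t \<le> ereal r}) = {y. ereal b < \<phi> y}"
    by auto
  finally show ?thesis .
qed

text \<open>A criterion through finite values: a point of the epigraph lies above a finite value of
  \<open>\<phi>\<close>, so convexity has to be checked only there, and lower semicontinuity makes
  the epigraph closed.\<close>

lemma closed_convex_on_UNIV_I:
  fixes \<phi> :: "'a::real_normed_vector \<Rightarrow> ereal"
  assumes "\<And>y. \<phi> y \<noteq> -\<infinity>"
    and "\<And>b. open {y. ereal b < \<phi> y}"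
    and conv: "\<And>x y a b t. \<phi> x = ereal a \<Longrightarrow> \<phi> y = ereal b \<Longrightarrow> 0 \<le> t \<Longrightarrow> t \<le> 1
      \<Longrightarrow> \<phi> ((1 - t) *\<^sub>R x + t *\<^sub>R y) \<le> ereal ((1 - t) * a + t * b)"
  shows "closed_convex_on UNIV \<phi>"
  unfolding closed_convex_on_def
proof (intro conjI ballI)
  show "\<phi> t \<noteq> -\<infinity>" for t using assms(1) .
  show "convex {(t, r). t \<in> UNIV \<and> \<phi> t \<le> ereal r}"
  proof (rule convexI, clarsimp)
    fix x y :: 'a and r s u v :: real
    assume le: "\<phi> x \<le> ereal r" "\<phi> y \<le> ereal s" and uv: "0 \<le> u" "0 \<le> v" "u + v = 1"
    obtain a where a: "\<phi> x = ereal a" using le assms(1)[of x] by (cases "\<phi> x") auto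
    obtain b where b: "\<phi> y = ereal b" using le assms(1)[of y] by (cases "\<phi> y") auto
    have u: "u = 1 - v" using uv by simp
    have "\<phi> (u *\<^sub>R x + v *\<^sub>R y) \<le> ereal (u * a + v * b)"
      using conv[OF a b, of v] uv by (simp add: u)
    also have "\<dots> \<le> ereal (u * r + v * s)"
      using le uv a b by (auto intro!: add_mono mult_left_mono)
    finally show "\<phi> (u *\<^sub>R x + v *\<^sub>R y) \<le> ereal (u * r + v * s)" .
  qed
  \<comment> \<open>A point strictly below the graph leaves room for a real \<open>b\<close> between
    its height and the value of \<open>\<phi>\<close>, so the complement is a union of open
    boxes.\<close>
  have "- {(t, r). t \<in> UNIV \<and> \<phi> t \<le> ereal r} = (\<Union>b. {y. ereal b < \<phi> y} \<times> {..<b})"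
    (is "?L = ?R")
  proof (intro equalityI subsetI)
    fix p assume "p \<in> ?L"
    then obtain t r where p: "p = (t, r)" "ereal r < \<phi> t" by (cases p) auto
    then obtain b where "ereal r < ereal b" "ereal b < \<phi> t"
      using ereal_dense2 by blast
    then show "p \<in> ?R" using p by auto
  next
    fix p assume "p \<in> ?R"
    then obtain t r b where "p = (t, r)" "ereal b < \<phi> t" "r < b" by auto
    then show "p \<in> ?L" by (auto simp: not_le intro: less_trans[of _ "ereal b"])
  qed
  then show "closed {(t, r). t \<in> UNIV \<and> \<phi> t \<le> ereal r}"
    unfolding closed_def using assms(2) by (auto intro!: open_Times)
qed

lemma closed_convex_on_convexD:
  assumes "closed_convex_on UNIV \<phi>" "\<phi> x = ereal a" "\<phi> y = ereal b" "0 \<le> t" "t \<le> 1"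
  shows "\<phi> ((1 - t) *\<^sub>R x + t *\<^sub>R y) \<le> ereal ((1 - t) * a + t * b)"
proof -
  have "convex {(t, r). t \<in> UNIV \<and> \<phi> t \<le> ereal r}"
    using assms(1) by (simp add: closed_convex_on_def)
  from convexD[OF this, of "(x, a)" "(y, b)" "1 - t" t] show ?thesis using assms by simp
qed

lemma closed_convex_on_add:
  assumes "closed_convex_on UNIV \<phi>" "closed_convex_on UNIV \<gamma>"
  shows "closed_convex_on UNIV (\<lambda>y. \<phi> y + \<gamma> y)"
proof (rule closed_convex_on_UNIV_I)
  have nm: "\<phi> y \<noteq> -\<infinity>" "\<gamma> y \<noteq> -\<infinity>" for y using assms by (auto simp: closed_convex_on_def)
  then show "\<phi> y + \<gamma> y \<noteq> -\<infinity>" for y by auto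
  \<comment> \<open>The bound \<open>b\<close> is distributed over the two summands in all possible
    ways, which exhibits the set as a union of open sets.\<close>
  have "{y. ereal b < \<phi> y + \<gamma> y} = (\<Union>c. {y. ereal c < \<phi> y} \<inter> {y. ereal (b - c) < \<gamma> y})"
    (is "?L = ?R") for b
  proof (intro equalityI subsetI)
    fix y assume "y \<in> ?L"
    then have less: "ereal b < \<phi> y + \<gamma> y" by simp
    have "\<exists>c. ereal c < \<phi> y \<and> ereal (b - c) < \<gamma> y"
    proof (cases "\<phi> y")
      case (real u)
      show ?thesis
      proof (cases "\<gamma> y")
        case (real v)
        \<comment> \<open>The surplus \<open>u + v - b\<close> is split evenly, so each of the two
          values is undercut by half of it.\<close>
        then show ?thesis using \<open>\<phi> y = ereal u\<close> less
          by (intro exI[of _ "u - (u + v - b) / 2"]) (auto simp: field_simps)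
      next
        case PInf
        then show ?thesis using real by (intro exI[of _ "u - 1"]) auto
      qed (use nm in auto)
    next
      case PInf
      obtain v where "ereal v < \<gamma> y" using nm(2)[of y] by (metis ereal_bot le_less_linear)
      then show ?thesis using PInf by (intro exI[of _ "b - v"]) auto
    qed (use nm in auto)
    then show "y \<in> ?R" by auto
  next
    fix y assume "y \<in> ?R"
    then obtain c where "ereal c < \<phi> y" "ereal (b - c) < \<gamma> y" by auto
    then have "ereal c + ereal (b - c) < \<phi> y + \<gamma> y" by (rule ereal_add_strict_mono2)
    then show "y \<in> ?L" by simp
  qed
  then show "open {y. ereal b < \<phi> y + \<gamma> y}" for b
    using assms by (auto intro!: open_Int closed_convex_on_superlevel_open)
  fix x y a b and t :: real
  assume *: "\<phi> x + \<gamma> x = ereal a" "\<phi> y + \<gamma> y = ereal b" "0 \<le> t" "t \<le> 1"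
  obtain a1 a2 where a: "\<phi> x = ereal a1" "\<gamma> x = ereal a2"
    using *(1) nm[of x] by (cases "\<phi> x"; cases "\<gamma> x") auto
  obtain b1 b2 where b: "\<phi> y = ereal b1" "\<gamma> y = ereal b2"
    using *(2) nm[of y] by (cases "\<phi> y"; cases "\<gamma> y") auto
  have "\<phi> ((1 - t) *\<^sub>R x + t *\<^sub>R y) + \<gamma> ((1 - t) *\<^sub>R x + t *\<^sub>R y)
      \<le> ereal ((1 - t) * a1 + t * b1) + ereal ((1 - t) * a2 + t * b2)"
    using a b * assms by (intro add_mono closed_convex_on_convexD) auto
  also have "\<dots> = ereal ((1 - t) * a + t * b)"
    using * a b by (auto simp: algebra_simps)
  finally show "\<phi> ((1 - t) *\<^sub>R x + t *\<^sub>R y) + \<gamma> ((1 - t) *\<^sub>R x + t *\<^sub>R y)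
      \<le> ereal ((1 - t) * a + t * b)" .
qed

lemma closed_convex_on_ereal:
  fixes f :: "'a::real_normed_vector \<Rightarrow> real"
  assumes "convex_on UNIV f" "continuous_on UNIV f"
  shows "closed_convex_on UNIV (\<lambda>y. ereal (f y))"
proof (rule closed_convex_on_UNIV_I)
  show "open {y. ereal b < ereal (f y)}" for b
    using assms(2) by (auto intro!: open_Collect_less continuous_intros)
qed (use assms(1) in \<open>auto intro!: convex_onD\<close>)

lemma closed_convex_on_sum:
  assumes "finite A" "\<And>i. i \<in> A \<Longrightarrow> closed_convex_on UNIV (\<phi> i)"
  shows "closed_convex_on UNIV (\<lambda>y. \<Sum>i\<in>A. \<phi> i y)"
  using assms
proof (induction A rule: finite_induct)
  case empty
  have "closed_convex_on UNIV (\<lambda>y::'b. ereal 0)"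
    by (intro closed_convex_on_ereal) (auto simp: convex_on_def)
  then show ?case by (simp add: zero_ereal_def)
next
  case (insert i A)
  then show ?case by (auto intro: closed_convex_on_add)
qed

text \<open>The new epigraph is the preimage of the old one under a continuous linear map. This
  carries each \<open>\<psi> i\<close>, which is closed convex on its block space, to the whole
  space.\<close>

lemma closed_convex_on_compose_linear:
  fixes L :: "'a::real_normed_vector \<Rightarrow> 'b::real_normed_vector"
  assumes "closed_convex_on D \<phi>" "bounded_linear L" "\<And>y. L y \<in> D"
  shows "closed_convex_on UNIV (\<lambda>y. \<phi> (L y))"
proof -
  interpret bounded_linear L by fact
  let ?m = "\<lambda>p :: 'a \<times> real. (L (fst p), snd p)"
  have eq: "{(t, r). t \<in> UNIV \<and> \<phi> (L t) \<le> ereal r} = ?m -` {(t, r). t \<in> D \<and> \<phi> t \<le> ereal r}"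
    using assms(3) by auto
  have "linear ?m"
    by (rule linearI) (auto simp: add scaleR)
  moreover have "continuous_on UNIV ?m"
    by (intro continuous_intros continuous_on)
  ultimately show ?thesis
    unfolding closed_convex_on_def eq using assms
    by (intro conjI ballI convex_linear_vimage closed_vimage) (auto simp: closed_convex_on_def)
qed

section \<open>Proximal points and strong convexity along segments\<close>

lemma norm_add_scaleR_sq:
  fixes u v :: "'a::real_inner"
  shows "(norm (u + t *\<^sub>R v))\<^sup>2 = (norm u)\<^sup>2 + 2 * t * (u \<bullet> v) + t\<^sup>2 * (norm v)\<^sup>2"
  unfolding power2_norm_eq_inner power2_eq_square[of t]
  by (simp add: inner_add_left inner_add_right inner_commute algebra_simps)

text \<open>
  The minimizer \<open>p\<close> of \<open>\<phi> y + c * (norm (y - z))\<^sup>2\<close> is a point near \<open>z\<close> at which a subgradient of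
  \<open>\<phi>\<close> exists; at \<open>z\<close> itself the subdifferential may be empty.
\<close>

lemma closed_convex_on_prox:
  fixes \<phi> :: "'a::euclidean_space \<Rightarrow> ereal"
  assumes cc: "closed_convex_on UNIV \<phi>" and bd: "\<And>y. ereal m \<le> \<phi> y"
    and z: "\<phi> z = ereal b" and c: "0 < c"
  obtains p a where "\<phi> p = ereal a" "a + c * (norm (p - z))\<^sup>2 \<le> b"
    "is_subgradient \<phi> p ((2 * c) *\<^sub>R (z - p))"
proof -
  let ?epi = "{(t, r). t \<in> UNIV \<and> \<phi> t \<le> ereal r}"
  \<comment> \<open>Minimizing over the epigraph instead of over \<open>y\<close> makes the
    objective continuous. Cutting at the level \<open>b\<close> attained by \<open>(z, b)\<close>
    makes the set compact, since \<open>m\<close> bounds the heights from below.\<close>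
  let ?g = "\<lambda>q :: 'a \<times> real. snd q + c * (norm (fst q - z))\<^sup>2"
  let ?C = "?epi \<inter> {q. ?g q \<le> b}"
  have "closed ?C"
    using cc unfolding closed_convex_on_def
    by (intro closed_Int closed_Collect_le continuous_intros) auto
  moreover have "bounded ?C"
  proof (rule bounded_subset)
    show "bounded (cball z (sqrt ((b - m) / c)) \<times> {m..b})"
      by (intro bounded_Times) auto
    show "?C \<subseteq> cball z (sqrt ((b - m) / c)) \<times> {m..b}"
    proof (clarsimp)
      fix t r assume *: "\<phi> t \<le> ereal r" "r + c * (norm (t - z))\<^sup>2 \<le> b"
      have mr: "m \<le> r" using order_trans[OF bd[of t] *(1)] by simp
      have cn: "0 \<le> c * (norm (t - z))\<^sup>2" using c by simp
      have "(norm (t - z))\<^sup>2 \<le> (b - m) / c" using * mr c by (simp add: field_simps)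
      then have "norm (t - z) \<le> sqrt ((b - m) / c)" by (rule real_le_rsqrt)
      then show "dist z t \<le> sqrt ((b - m) / c) \<and> m \<le> r \<and> r \<le> b"
        using mr * cn by (auto simp: dist_norm norm_minus_commute)
    qed
  qed
  ultimately have "compact ?C" by (simp add: compact_eq_bounded_closed)
  moreover have "(z, b) \<in> ?C" using z by simp
  then have "?C \<noteq> {}" by blast
  moreover have "continuous_on ?C ?g" by (intro continuous_intros)
  ultimately obtain q where q: "q \<in> ?C" "\<And>q'. q' \<in> ?C \<Longrightarrow> ?g q \<le> ?g q'"
    using continuous_attains_inf[of ?C ?g] by blast
  obtain p r where pr: "q = (p, r)" by (cases q)
  have "\<phi> p \<le> ereal r" using q pr by simp
  then obtain a where a: "\<phi> p = ereal a" "a \<le> r"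
    using bd[of p] by (cases "\<phi> p") auto
  have le: "a + c * (norm (p - z))\<^sup>2 \<le> b" using q pr a by simp
  have min: "a + c * (norm (p - z))\<^sup>2 \<le> s + c * (norm (y - z))\<^sup>2" if "\<phi> y \<le> ereal s" for y s
  proof (cases "s + c * (norm (y - z))\<^sup>2 \<le> b")
    case True
    then show ?thesis using q(2)[of "(y, s)"] that pr a by simp
  qed (use le in simp)
  have "is_subgradient \<phi> p ((2 * c) *\<^sub>R (z - p))"
    unfolding is_subgradient_def
  proof
    fix y
    show "\<phi> p + ereal ((2 * c) *\<^sub>R (z - p) \<bullet> (y - p)) \<le> \<phi> y"
    proof (cases "\<phi> y")
      case (real s)
      let ?A = "s - a + 2 * c * ((p - z) \<bullet> (y - p))" and ?N = "c * (norm (y - p))\<^sup>2"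
      \<comment> \<open>Minimality of \<open>p\<close> is tested at the point a fraction
        \<open>t\<close> of the way to \<open>y\<close>. After division by \<open>t\<close> the
        quadratic term vanishes as \<open>t\<close> tends to 0, and the subgradient inequality
        remains.\<close>
      have "0 \<le> ?A + t * ?N" if t: "0 < t" "t \<le> 1" for t
      proof -
        have "(1 - t) *\<^sub>R p + t *\<^sub>R y - z = (p - z) + t *\<^sub>R (y - p)" by (simp add: algebra_simps)
        then have n: "(norm ((1 - t) *\<^sub>R p + t *\<^sub>R y - z))\<^sup>2
            = (norm (p - z))\<^sup>2 + 2 * t * ((p - z) \<bullet> (y - p)) + t\<^sup>2 * (norm (y - p))\<^sup>2"
          by (simp only: norm_add_scaleR_sq)
        have "a + c * (norm (p - z))\<^sup>2
            \<le> (1 - t) * a + t * s + c * (norm ((1 - t) *\<^sub>R p + t *\<^sub>R y - z))\<^sup>2"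
          using closed_convex_on_convexD[OF cc a(1) real] t by (intro min) auto
        then have "0 \<le> t * (?A + t * ?N)"
          unfolding n by (simp add: algebra_simps power2_eq_square)
        then show ?thesis using t by (simp add: zero_le_mult_iff)
      qed
      then have "\<forall>\<^sub>F t in at_right 0. 0 \<le> ?A + t * ?N"
        by (intro eventually_at_rightI[of 0 1]) auto
      moreover have "((\<lambda>t. ?A + t * ?N) \<longlongrightarrow> ?A + 0 * ?N) (at_right 0)"
        by (intro tendsto_intros)
      ultimately have "0 \<le> ?A + 0 * ?N"
        by (intro tendsto_lowerbound[of _ _ "at_right 0"]) auto
      moreover have "(z - p) \<bullet> (y - p) = - ((p - z) \<bullet> (y - p))"
        by (simp add: inner_diff_left)
      ultimately show ?thesis using real a by simp
    qed (use a bd[of y] in auto)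
  qed
  then show thesis using that a le by blast
qed

text \<open>
  The subgradient inequalities at the proximal points \<open>p n\<close> of \<open>z\<close> are combined, and the limit
  \<open>p n \<longlonglongrightarrow> z\<close> is taken by lower semicontinuity; the term \<open>2 * c * ((z - p) \<bullet> (z - p))\<close> that the
  subgradients contribute has the right sign.
\<close>

lemma strong_convexity_segment:
  fixes \<phi> :: "'a::euclidean_space \<Rightarrow> ereal"
  assumes cc: "closed_convex_on UNIV \<phi>" and bd: "\<And>y. ereal m \<le> \<phi> y"
    and param: "convexity_param nrm \<phi> \<mu>"
    and nrm_cont: "continuous_on UNIV nrm"
    and nrm_scale: "\<And>c x. (nrm (c *\<^sub>R x))\<^sup>2 = c\<^sup>2 * (nrm x)\<^sup>2"
    and x: "\<phi> x = ereal a" and y: "\<phi> y = ereal b" and l: "0 \<le> l" "l \<le> 1"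
  shows "\<phi> ((1 - l) *\<^sub>R x + l *\<^sub>R y)
    \<le> ereal ((1 - l) * a + l * b - \<mu> / 2 * (l * (1 - l) * (nrm (y - x))\<^sup>2))"
proof -
  define z where "z = (1 - l) *\<^sub>R x + l *\<^sub>R y"
  define V where "V = (1 - l) * a + l * b"
  \<comment> \<open>\<open>R p\<close> is the convex combination, with weights \<open>1 - l\<close>
    and \<open>l\<close>, of the quadratic terms in the strong convexity inequalities from
    \<open>p\<close> to \<open>x\<close> and to \<open>y\<close>.\<close>
  define R where "R p = \<mu> / 2 * ((1 - l) * (nrm (x - p))\<^sup>2 + l * (nrm (y - p))\<^sup>2)" for p
  have mu: "0 \<le> \<mu>" using param by (simp add: convexity_param_def)
  have "\<phi> z \<le> ereal V"
    unfolding z_def V_def using cc x y l by (rule closed_convex_on_convexD)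
  then obtain d where d: "\<phi> z = ereal d" using bd[of z] by (cases "\<phi> z") auto
  have md: "m \<le> d" using bd[of z] d by simp
  \<comment> \<open>The proximal penalty is \<open>Suc n\<close>: positive for every
    \<open>n\<close> and growing, so the proximal points are forced to \<open>z\<close>.\<close>
  have "\<exists>p. \<exists>r. \<phi> p = ereal r \<and> r + R p \<le> V \<and> (norm (p - z))\<^sup>2 \<le> (d - m) / real (Suc n)" for n
  proof -
    define c where "c = real (Suc n)"
    have c: "0 < c" by (simp add: c_def)
    obtain p r where p: "\<phi> p = ereal r" "r + c * (norm (p - z))\<^sup>2 \<le> d"
      and sub: "is_subgradient \<phi> p ((2 * c) *\<^sub>R (z - p))"
      by (rule closed_convex_on_prox[OF cc bd d c])
    have below: "r + 2 * c * ((z - p) \<bullet> (v - p)) + \<mu> / 2 * (nrm (v - p))\<^sup>2 \<le> s"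
      if "\<phi> v = ereal s" for v s
    proof -
      have "\<phi> p + ereal ((2 * c) *\<^sub>R (z - p) \<bullet> (v - p)) + ereal (\<mu> / 2 * (nrm (v - p))\<^sup>2) \<le> \<phi> v"
      proof -
        have "p \<in> edom \<phi>" "v \<in> edom \<phi>" using p that by (simp_all add: edom_def)
        then show ?thesis using param sub unfolding convexity_param_def by blast
      qed
      then show ?thesis using p that by simp
    qed
    have "(1 - l) * ((z - p) \<bullet> (x - p)) + l * ((z - p) \<bullet> (y - p)) = (z - p) \<bullet> (z - p)"
    proof -
      have "z - p = (1 - l) *\<^sub>R (x - p) + l *\<^sub>R (y - p)"
        by (simp add: z_def algebra_simps)
      then have "(z - p) \<bullet> (z - p) = (z - p) \<bullet> ((1 - l) *\<^sub>R (x - p) + l *\<^sub>R (y - p))" by simp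
      then show ?thesis by (simp only: inner_add_right inner_scaleR_right)
    qed
    then have "r + R p + 2 * c * ((z - p) \<bullet> (z - p))
        = r + R p + 2 * c * ((1 - l) * ((z - p) \<bullet> (x - p)) + l * ((z - p) \<bullet> (y - p)))"
      by (simp only:)
    also have "\<dots>
        = (1 - l) * (r + 2 * c * ((z - p) \<bullet> (x - p)) + \<mu> / 2 * (nrm (x - p))\<^sup>2)
          + l * (r + 2 * c * ((z - p) \<bullet> (y - p)) + \<mu> / 2 * (nrm (y - p))\<^sup>2)"
      unfolding R_def by (simp add: field_simps)
    also have "\<dots> \<le> (1 - l) * a + l * b"
      using below[OF x] below[OF y] l by (intro add_mono mult_left_mono) auto
    finally have "r + R p \<le> V"
      using mult_nonneg_nonneg[of "2 * c" "(z - p) \<bullet> (z - p)"] c inner_ge_zero[of "z - p"]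
      unfolding V_def by linarith
    moreover have "m \<le> r" using bd[of p] p by simp
    then have "(norm (p - z))\<^sup>2 \<le> (d - m) / c" using p c by (simp add: field_simps)
    ultimately show ?thesis using p(1) unfolding c_def by (intro exI conjI)
  qed
  then obtain p r where p: "\<And>n. \<phi> (p n) = ereal (r n)" "\<And>n. r n + R (p n) \<le> V"
    "\<And>n. (norm (p n - z))\<^sup>2 \<le> (d - m) / real (Suc n)"
    by metis
  have "(\<lambda>n. sqrt ((d - m) / real (Suc n))) \<longlonglongrightarrow> sqrt 0"
    by (intro tendsto_real_sqrt LIMSEQ_Suc[OF lim_const_over_n])
  then have "(\<lambda>n. norm (p n - z)) \<longlonglongrightarrow> 0"
    by (intro Lim_null_comparison[of "\<lambda>n. norm (p n - z)", OF always_eventually[OF allI]])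
      (simp_all only: real_norm_def abs_norm_cancel real_sqrt_zero real_le_rsqrt[OF p(3)])
  then have lim: "p \<longlonglongrightarrow> z" by (rule LIM_zero_cancel[OF tendsto_norm_zero_cancel])
  have limR: "(\<lambda>n. R (p n)) \<longlonglongrightarrow> R z"
  proof -
    have "(\<lambda>n. nrm (v - p n)) \<longlonglongrightarrow> nrm (v - z)" for v
      using nrm_cont lim
      by (intro continuous_on_tendsto_compose[OF nrm_cont]) (auto intro!: tendsto_intros)
    then show ?thesis unfolding R_def by (intro tendsto_intros)
  qed
  \<comment> \<open>Lower semicontinuity keeps the values at \<open>p n\<close> eventually above any
    \<open>e < d\<close>, so the inequality passes to the limit for each such \<open>e\<close>, and
    then for their supremum \<open>d\<close>.\<close>
  have le: "e + R z \<le> V" if "e < d" for e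
  proof -
    have "\<forall>\<^sub>F n in sequentially. p n \<in> {y. ereal e < \<phi> y}"
      using lim closed_convex_on_superlevel_open[OF cc, of e] that d
      by (intro topological_tendstoD) auto
    then have "\<forall>\<^sub>F n in sequentially. e + R (p n) \<le> V"
    proof eventually_elim
      case (elim n)
      then show ?case using p(1)[of n] p(2)[of n] by simp
    qed
    then show ?thesis
      by (rule tendsto_upperbound[OF tendsto_add[OF tendsto_const limR]]) simp
  qed
  have "d \<le> V - R z"
  proof (rule dense_le)
    show "e \<le> V - R z" if "e < d" for e using le[OF that] by simp
  qed
  \<comment> \<open>The distances from \<open>z\<close> to the endpoints scale by \<open>l\<close>
    and \<open>1 - l\<close>, and (1 - l) l^2 + l (1 - l)^2 = l (1 - l).\<close>
  moreover have "R z = \<mu> / 2 * (l * (1 - l) * (nrm (y - x))\<^sup>2)"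
  proof -
    have "x - z = (- l) *\<^sub>R (y - x)" "y - z = (1 - l) *\<^sub>R (y - x)"
      by (auto simp: z_def algebra_simps)
    then show ?thesis unfolding R_def by (simp only: nrm_scale) (simp add: power2_eq_square algebra_simps)
  qed
  ultimately have "d \<le> V - \<mu> / 2 * (l * (1 - l) * (nrm (y - x))\<^sup>2)" by (simp only:)
  then have "\<phi> z \<le> ereal (V - \<mu> / 2 * (l * (1 - l) * (nrm (y - x))\<^sup>2))"
    by (simp only: d ereal_less_eq)
  then show ?thesis by (simp only: z_def V_def)
qed

text \<open>Restriction to the line through \<open>x\<close> and \<open>y\<close> reduces this to
  the tangent inequality for a convex function of one real variable.\<close>

lemma gradient_lower_bound:
  fixes f :: "'a::real_inner \<Rightarrow> real"
  assumes "convex_on UNIV f" "GDERIV f x :> g"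
  shows "f x + g \<bullet> (y - x) \<le> f y"
proof -
  let ?L = "\<lambda>t :: real. x + t *\<^sub>R (y - x)"
  have "convex_on UNIV (\<lambda>t. f (?L t))"
  proof (rule convex_onI)
    fix t u v :: real assume t: "0 < t" "t < 1"
    have "?L ((1 - t) *\<^sub>R u + t *\<^sub>R v) = (1 - t) *\<^sub>R ?L u + t *\<^sub>R ?L v"
      by (simp add: algebra_simps)
    then show "f (?L ((1 - t) *\<^sub>R u + t *\<^sub>R v)) \<le> (1 - t) * f (?L u) + t * f (?L v)"
      using convex_onD[OF assms(1), of t] t by (simp only:) auto
  qed auto
  moreover have "((\<lambda>t. f (?L t)) has_real_derivative (g \<bullet> (y - x))) (at 0)"
  proof -
    have "(?L has_derivative (\<lambda>t. t *\<^sub>R (y - x))) (at 0)"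
      by (auto intro!: derivative_eq_intros)
    moreover have "(f has_derivative (\<lambda>h. h \<bullet> g)) (at (?L 0))"
      using assms(2) by (simp add: gderiv_def inner_commute)
    ultimately have "((\<lambda>t. f (?L t)) has_derivative (\<lambda>t. (t *\<^sub>R (y - x)) \<bullet> g)) (at 0)"
      by (rule has_derivative_compose)
    then show ?thesis
      by (simp add: has_field_derivative_def inner_commute mult_commute_abs)
  qed
  ultimately have "(g \<bullet> (y - x)) * (1 - 0) \<le> f (?L 1) - f (?L 0)"
    by (intro convex_on_imp_above_tangent[of UNIV]) auto
  then show ?thesis by simp
qed

text \<open>The parameter is defined through subgradients; by the tangent inequality the gradient is
  one of them.\<close>

lemma convexity_param_gradient:
  assumes "convex_on UNIV f" "GDERIV f x :> g" "convexity_param nrm (\<lambda>y. ereal (f y)) \<mu>"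
  shows "f x + g \<bullet> (y - x) + \<mu> / 2 * (nrm (y - x))\<^sup>2 \<le> f y"
proof -
  have "is_subgradient (\<lambda>y. ereal (f y)) x g"
    using gradient_lower_bound[OF assms(1,2)] by (simp add: is_subgradient_def)
  then show ?thesis using assms(3) by (auto simp: convexity_param_def edom_def)
qed

subsection \<open>Blocks and the weighted norm\<close>

lemma linear_block: "linear (block blk i :: real ^ 'm::finite \<Rightarrow> _)"
  by (rule linearI) (auto simp: block_def vec_eq_iff)

lemma block_in_block_space [simp]: "block blk i x \<in> block_space blk i"
  by (simp add: block_def block_space_def)

lemma block_block: "block blk i (block blk j x) = (if i = j then block blk i x else 0)"
  by (auto simp: block_def vec_eq_iff)

lemma block_sum_block:
  fixes h :: "real ^ 'm::finite" and s :: "'b::finite set"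
  shows "block blk i (\<Sum>j\<in>s. block blk j h) = (if i \<in> s then block blk i h else 0)"
  by (simp add: linear_sum[OF linear_block] block_block)

lemma sum_block: "(\<Sum>i\<in>UNIV. block blk i x) = x" for blk :: "'m::finite \<Rightarrow> 'b::finite"
  by (simp add: block_def vec_eq_iff)

lemma posdef_block_nonneg:
  assumes "posdef_block blk i B" "t \<in> block_space blk i"
  shows "0 \<le> (B *v t) \<bullet> t"
  using assms by (cases "t = 0") (auto simp: posdef_block_def intro: less_imp_le)

text \<open>The bilinear form whose diagonal is the squared weighted norm; identities for squared
  norms then follow from bilinearity.\<close>

definition w_form ::
  "('m::finite \<Rightarrow> 'b::finite) \<Rightarrow> ('b \<Rightarrow> real ^ 'm ^ 'm) \<Rightarrow> ('b \<Rightarrow> real) \<Rightarrow>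
   real ^ 'm \<Rightarrow> real ^ 'm \<Rightarrow> real" where
  "w_form blk B w x y = (\<Sum>i\<in>UNIV. w i * ((B i *v block blk i x) \<bullet> block blk i y))"

lemma bilinear_w_form: "bilinear (w_form blk B w)"
  unfolding bilinear_def
proof (intro conjI allI)
  show "linear (w_form blk B w x)" for x
    by (rule linearI)
      (simp_all add: w_form_def linear_add[OF linear_block] linear_cmul[OF linear_block]
        inner_add_right sum.distrib sum_distrib_left distrib_left mult.left_commute)
  show "linear (\<lambda>x. w_form blk B w x y)" for y
    by (rule linearI)
      (simp_all add: w_form_def linear_add[OF linear_block] linear_cmul[OF linear_block]
        matrix_vector_right_distrib matrix_vector_mult_scaleR
        inner_add_left sum.distrib sum_distrib_left distrib_left mult.left_commute)
qed

context
  fixes blk :: "'m::finite \<Rightarrow> 'b::finite" and B :: "'b \<Rightarrow> real ^ 'm ^ 'm" and w :: "'b \<Rightarrow> real"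
  assumes posdef: "\<And>i. posdef_block blk i (B i)" and w_pos: "\<And>i. 0 < w i"
begin

lemma norm_w_sq: "(norm_w blk B w x)\<^sup>2 = w_form blk B w x x"
proof -
  have "0 \<le> w_form blk B w x x"
    unfolding w_form_def using w_pos
    by (intro sum_nonneg mult_nonneg_nonneg posdef_block_nonneg[OF posdef]) (auto intro: less_imp_le)
  then show ?thesis
    using posdef_block_nonneg[OF posdef, OF block_in_block_space]
    by (simp add: norm_w_def block_norm_def w_form_def)
qed

lemma norm_w_eq_sqrt: "norm_w blk B w x = sqrt (w_form blk B w x x)"
  using posdef_block_nonneg[OF posdef, OF block_in_block_space]
  by (simp add: norm_w_def block_norm_def w_form_def)

lemma norm_w_scaleR_sq: "(norm_w blk B w (c *\<^sub>R x))\<^sup>2 = c\<^sup>2 * (norm_w blk B w x)\<^sup>2"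
  unfolding norm_w_sq
  by (simp add: bilinear_lmul[OF bilinear_w_form] bilinear_rmul[OF bilinear_w_form]
      power2_eq_square)

lemma norm_w_sq_pos:
  assumes "x \<noteq> 0"
  shows "0 < (norm_w blk B w x)\<^sup>2"
proof -
  obtain i where i: "block blk i x \<noteq> 0"
  proof (rule ccontr)
    assume "\<not> thesis"
    then have "block blk i x = 0" for i using that by (cases "block blk i x = 0") auto
    then have "(\<Sum>i\<in>UNIV. block blk i x) = 0" by simp
    then show False using assms sum_block[of blk x] by simp
  qed
  have "0 < (B i *v block blk i x) \<bullet> block blk i x"
    using posdef[of i] i by (simp add: posdef_block_def)
  then have "0 < w i * ((B i *v block blk i x) \<bullet> block blk i x)" using w_pos by simp
  moreover have "0 \<le> w j * ((B j *v block blk j x) \<bullet> block blk j x)" for j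
    using w_pos posdef_block_nonneg[OF posdef, OF block_in_block_space] by (simp add: less_imp_le)
  ultimately show ?thesis
    unfolding norm_w_sq w_form_def by (intro sum_pos2[of _ i]) simp_all
qed

text \<open>This is the parallelogram law. The subtracted term is the strict convexity that makes
  the minimizer of the model unique.\<close>

lemma norm_w_midpoint_sq:
  "(norm_w blk B w ((1 / 2) *\<^sub>R (x + y)))\<^sup>2
    = (norm_w blk B w x)\<^sup>2 / 2 + (norm_w blk B w y)\<^sup>2 / 2 - (norm_w blk B w (x - y))\<^sup>2 / 4"
  unfolding norm_w_scaleR_sq unfolding norm_w_sq
  by (simp add: bilinear_ladd[OF bilinear_w_form] bilinear_radd[OF bilinear_w_form]
      bilinear_lsub[OF bilinear_w_form] bilinear_rsub[OF bilinear_w_form] field_simps power2_eq_square)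

text \<open>Different blocks are orthogonal for \<open>w_form\<close>, so the squared norm is
  additive over blocks and can be averaged over the sampling block by block.\<close>

lemma norm_w_sum_block_sq:
  "(norm_w blk B w (\<Sum>i\<in>s. block blk i h))\<^sup>2
    = (\<Sum>i\<in>s. w i * ((B i *v block blk i h) \<bullet> block blk i h))"
  unfolding norm_w_sq w_form_def block_sum_block
  by (intro sum.mono_neutral_cong_right) auto

lemma continuous_norm_w: "continuous_on UNIV (norm_w blk B w)"
proof -
  have cont: "continuous_on UNIV (block blk i)" for i
    using linear_block by (rule linear_continuous_on[OF linear_linear[THEN iffD2]])
  have contB: "continuous_on UNIV (\<lambda>x. B i *v block blk i x)" for i
    by (rule continuous_on_compose2[OF matrix_vector_mult_linear_continuous_on cont]) auto
  have "continuous_on UNIV (\<lambda>x. w_form blk B w x x)"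
    unfolding w_form_def by (intro continuous_intros cont contB)
  then show ?thesis
    unfolding norm_w_eq_sqrt by (intro continuous_intros)
qed

end

subsection \<open>Expectations over finite samplings\<close>

lemma (in prob_space) integrable_finite_valued:
  fixes g :: "'c \<Rightarrow> real"
  assumes "Y \<in> measurable M (count_space A)" "finite A"
  shows "integrable M (\<lambda>\<omega>. g (Y \<omega>))"
proof (rule integrable_const_bound)
  show "(\<lambda>\<omega>. g (Y \<omega>)) \<in> borel_measurable M"
    using assms(1) by (rule measurable_compose) simp
  show "AE \<omega> in M. norm (g (Y \<omega>)) \<le> (\<Sum>a\<in>A. norm (g a))"
    using measurable_space[OF assms(1)] assms(2)
    by (intro AE_I2 member_le_sum[of _ A "\<lambda>a. norm (g a)"]) auto
qed

lemma (in prob_space) expectation_finite_type: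
  fixes g :: "'c::finite \<Rightarrow> real"
  assumes "Z \<in> measurable M (count_space UNIV)"
  shows "expectation (\<lambda>\<omega>. g (Z \<omega>)) = (\<Sum>z\<in>UNIV. prob {\<omega> \<in> space M. Z \<omega> = z} * g z)"
proof -
  have "expectation (\<lambda>\<omega>. g (Z \<omega>)) = expectation (\<lambda>\<omega>. \<Sum>z\<in>UNIV. of_bool (Z \<omega> = z) * g z)"
    by (intro Bochner_Integration.integral_cong) simp_all
  also have "\<dots> = (\<Sum>z\<in>UNIV. expectation (\<lambda>\<omega>. of_bool (Z \<omega> = z) * g z))"
    by (intro Bochner_Integration.integral_sum integrable_finite_valued[OF assms]) simp
  also have "\<dots> = (\<Sum>z\<in>UNIV. prob {\<omega> \<in> space M. Z \<omega> = z} * g z)"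
  proof (intro sum.cong refl)
    fix z
    have "{\<omega> \<in> space M. Z \<omega> = z} \<in> sets M"
      using measurable_sets[OF assms, of "{z}"] by (simp add: vimage_def Int_def conj_commute)
    moreover have "expectation (\<lambda>\<omega>. of_bool (Z \<omega> = z) * g z)
        = expectation (\<lambda>\<omega>. indicator {\<omega> \<in> space M. Z \<omega> = z} \<omega> * g z)"
      by (intro Bochner_Integration.integral_cong) (auto simp: indicator_def)
    ultimately show "expectation (\<lambda>\<omega>. of_bool (Z \<omega> = z) * g z)
        = prob {\<omega> \<in> space M. Z \<omega> = z} * g z"
      by simp
  qed
  finally show ?thesis .
qed

text \<open>This averages over \<open>Z\<close> with \<open>Y\<close> frozen. Splitting by the value
  of \<open>Z\<close> leaves products of a function of \<open>Y\<close> and an indicator of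
  \<open>Z\<close>, and independence factors each of them.\<close>

lemma (in prob_space) expectation_indep_finite:
  fixes g :: "'c \<Rightarrow> 'd::finite \<Rightarrow> real"
  assumes Y: "Y \<in> measurable M (count_space A)" and A: "finite A"
    and Z: "Z \<in> measurable M (count_space UNIV)"
    and indep: "\<And>(h :: 'c \<Rightarrow> real) (k :: 'd \<Rightarrow> real).
      indep_var borel (\<lambda>\<omega>. h (Y \<omega>)) borel (\<lambda>\<omega>. k (Z \<omega>))"
  shows "expectation (\<lambda>\<omega>. g (Y \<omega>) (Z \<omega>))
    = expectation (\<lambda>\<omega>. \<Sum>z\<in>UNIV. prob {\<omega> \<in> space M. Z \<omega> = z} * g (Y \<omega>) z)"
proof -
  have int: "integrable M (\<lambda>\<omega>. h (Y \<omega>))" "integrable M (\<lambda>\<omega>. k (Z \<omega>))" for h k :: "_ \<Rightarrow> real"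
    using integrable_finite_valued[OF Y A] integrable_finite_valued[OF Z] by auto
  have prod: "integrable M (\<lambda>\<omega>. g (Y \<omega>) z * of_bool (Z \<omega> = z))"
    "expectation (\<lambda>\<omega>. g (Y \<omega>) z * of_bool (Z \<omega> = z))
      = expectation (\<lambda>\<omega>. prob {\<omega> \<in> space M. Z \<omega> = z} * g (Y \<omega>) z)" for z
  proof -
    have ind: "indep_var borel (\<lambda>\<omega>. g (Y \<omega>) z) borel (\<lambda>\<omega>. of_bool (Z \<omega> = z) :: real)"
      by (rule indep)
    show "integrable M (\<lambda>\<omega>. g (Y \<omega>) z * of_bool (Z \<omega> = z))"
      by (rule indep_var_integrable[OF ind int(1) int(2)])
    have "expectation (\<lambda>\<omega>. of_bool (Z \<omega> = z) :: real) = prob {\<omega> \<in> space M. Z \<omega> = z}"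
      by (subst expectation_finite_type[OF Z]) (simp add: of_bool_def if_distrib cong: if_cong)
    then show "expectation (\<lambda>\<omega>. g (Y \<omega>) z * of_bool (Z \<omega> = z))
      = expectation (\<lambda>\<omega>. prob {\<omega> \<in> space M. Z \<omega> = z} * g (Y \<omega>) z)"
      by (subst indep_var_lebesgue_integral[OF ind int(1) int(2)]) simp
  qed
  have "expectation (\<lambda>\<omega>. g (Y \<omega>) (Z \<omega>))
      = expectation (\<lambda>\<omega>. \<Sum>z\<in>UNIV. g (Y \<omega>) z * of_bool (Z \<omega> = z))"
    by (intro Bochner_Integration.integral_cong) simp_all
  also have "\<dots> = (\<Sum>z\<in>UNIV. expectation (\<lambda>\<omega>. g (Y \<omega>) z * of_bool (Z \<omega> = z)))"
    by (intro Bochner_Integration.integral_sum prod)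
  also have "\<dots> = (\<Sum>z\<in>UNIV. expectation (\<lambda>\<omega>. prob {\<omega> \<in> space M. Z \<omega> = z} * g (Y \<omega>) z))"
    by (simp only: prod)
  also have "\<dots> = expectation (\<lambda>\<omega>. \<Sum>z\<in>UNIV. prob {\<omega> \<in> space M. Z \<omega> = z} * g (Y \<omega>) z)"
    by (intro Bochner_Integration.integral_sum[symmetric] int)
  finally show ?thesis .
qed

text \<open>The iterate \<open>x k\<close> is a function of the earlier samples, which take finitely
  many values and are independent of \<open>S k\<close>. Hence integrability is automatic, and the
  one-step bound can be averaged over the past and iterated.\<close>

lemma (in prob_space) expectation_contraction:
  fixes S :: "nat \<Rightarrow> 'a \<Rightarrow> 's::finite" and x :: "nat \<Rightarrow> 'a \<Rightarrow> 'c" and g :: "'c \<Rightarrow> real"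
  assumes indep: "indep_vars (\<lambda>_. count_space UNIV) S UNIV"
    and x_0: "\<And>\<omega>. \<omega> \<in> space M \<Longrightarrow> x 0 \<omega> = x0"
    and x_Suc: "\<And>\<omega> k. \<omega> \<in> space M \<Longrightarrow> x (Suc k) \<omega> = step (x k \<omega>) (S k \<omega>)"
    and contr: "\<And>\<omega> k. \<omega> \<in> space M \<Longrightarrow>
      (\<Sum>s\<in>UNIV. prob {\<omega> \<in> space M. S k \<omega> = s} * g (step (x k \<omega>) s)) \<le> c * g (x k \<omega>)"
    and c: "0 \<le> c"
  shows "integrable M (\<lambda>\<omega>. g (x k \<omega>))" "expectation (\<lambda>\<omega>. g (x k \<omega>)) \<le> c ^ k * g x0"
proof -
  define traj where "traj k y = rec_nat x0 (\<lambda>i v. step v (y i)) k" for k and y :: "nat \<Rightarrow> 's"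
  \<comment> \<open>Only samples with index below \<open>k\<close> enter \<open>x k\<close>. The
    index sets \<open>{..<k}\<close> and \<open>{k}\<close> are disjoint, which gives independence
    of \<open>S k\<close>; the restriction makes the range the finite set
    \<open>A k\<close>.\<close>
  define Y where "Y k \<omega> = restrict (\<lambda>i. S i \<omega>) {..<k}" for k \<omega>
  define A where "A k = PiE {..<k} (\<lambda>_. UNIV :: 's set)" for k :: nat
  have A: "finite (A k)" for k by (simp add: A_def finite_PiE)
  have traj_cong: "traj k y = traj k y'" if "\<And>i. i < k \<Longrightarrow> y i = y' i" for k y y'
    using that by (induction k) (auto simp: traj_def)
  have x_traj: "x k \<omega> = traj k (Y k \<omega>)" if \<omega>: "\<omega> \<in> space M" for k \<omega>
  proof -
    have "x k \<omega> = traj k (\<lambda>i. S i \<omega>)"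
      by (induction k) (simp_all add: traj_def x_0 x_Suc \<omega>)
    also have "\<dots> = traj k (Y k \<omega>)" by (rule traj_cong) (simp add: Y_def)
    finally show ?thesis .
  qed
  have indep_restrict: "indep_var (PiM {..<k} (\<lambda>_. count_space UNIV)) (Y k)
      (PiM {k} (\<lambda>_. count_space UNIV)) (\<lambda>\<omega>. restrict (\<lambda>i. S i \<omega>) {k})" for k
    unfolding Y_def by (rule indep_var_restrict[OF indep]) auto
  have Y: "Y k \<in> measurable M (count_space (A k))" for k
    using indep_var_rv1[OF indep_restrict] by (simp add: A_def count_space_PiM_finite)
  have S: "S k \<in> measurable M (count_space UNIV)" for k
    using indep by (auto simp: indep_vars_def)
  have indepYS: "indep_var borel (\<lambda>\<omega>. h (Y k \<omega>)) borel (\<lambda>\<omega>. h' (S k \<omega>))"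
    for k and h h' :: "_ \<Rightarrow> real"
  proof -
    have "indep_var borel (h \<circ> Y k) borel ((\<lambda>y. h' (y k)) \<circ> (\<lambda>\<omega>. restrict (\<lambda>i. S i \<omega>) {k}))"
      by (rule indep_var_compose[OF indep_restrict]) (simp_all add: count_space_PiM_finite)
    then show ?thesis by (simp add: comp_def)
  qed
  have int: "integrable M (\<lambda>\<omega>. h (Y k \<omega>))" for h :: "_ \<Rightarrow> real" and k
    by (rule integrable_finite_valued[OF Y A])
  have "integrable M (\<lambda>\<omega>. g (traj k (Y k \<omega>)))" for k by (rule int)
  then show intx: "integrable M (\<lambda>\<omega>. g (x k \<omega>))" for k
    by (subst Bochner_Integration.integrable_cong[OF refl]) (use x_traj in auto)
  show "expectation (\<lambda>\<omega>. g (x k \<omega>)) \<le> c ^ k * g x0"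
  proof (induction k)
    case 0
    have "expectation (\<lambda>\<omega>. g (x 0 \<omega>)) = expectation (\<lambda>_. g x0)"
      by (intro Bochner_Integration.integral_cong) (simp_all add: x_0)
    then show ?case by (simp add: prob_space)
  next
    case (Suc k)
    let ?p = "\<lambda>s. prob {\<omega> \<in> space M. S k \<omega> = s}"
    have "expectation (\<lambda>\<omega>. g (x (Suc k) \<omega>))
        = expectation (\<lambda>\<omega>. g (step (traj k (Y k \<omega>)) (S k \<omega>)))"
      by (intro Bochner_Integration.integral_cong) (simp_all add: x_Suc flip: x_traj)
    also have "\<dots> = expectation (\<lambda>\<omega>. \<Sum>s\<in>UNIV. ?p s * g (step (traj k (Y k \<omega>)) s))"
      by (rule expectation_indep_finite[OF Y A S indepYS])
    also have "\<dots> \<le> expectation (\<lambda>\<omega>. c * g (x k \<omega>))"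
      using contr[of _ k] x_traj
      by (intro integral_mono int integrable_mult_right intx) simp_all
    also have "\<dots> = c * expectation (\<lambda>\<omega>. g (x k \<omega>))" by simp
    also have "\<dots> \<le> c * (c ^ k * g x0)" using Suc c by (rule mult_left_mono)
    finally show ?case by simp
  qed
qed

lemma (in prob_space) expectation_of_bool_mem:
  assumes "S \<in> measurable M (count_space UNIV)"
  shows "expectation (\<lambda>\<omega>. of_bool (i \<in> S \<omega>) :: real) = prob {\<omega> \<in> space M. i \<in> S \<omega>}"
proof -
  have "{\<omega> \<in> space M. i \<in> S \<omega>} \<in> sets M"
    using measurable_sets[OF assms, of "{s. i \<in> s}"] by (simp add: vimage_def Int_def conj_commute)
  moreover have "expectation (\<lambda>\<omega>. of_bool (i \<in> S \<omega>) :: real)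
      = expectation (indicator {\<omega> \<in> space M. i \<in> S \<omega>})"
    by (intro Bochner_Integration.integral_cong) (auto simp: indicator_def)
  ultimately show ?thesis by simp
qed

text \<open>The cardinality is a sum of membership indicators, and expectation is linear.\<close>

lemma (in prob_space) mean_card_eq_sum:
  fixes S :: "'a \<Rightarrow> 'b::finite set"
  assumes "S \<in> measurable M (count_space UNIV)"
  shows "mean_card M S = (\<Sum>i\<in>UNIV. prob {\<omega> \<in> space M. i \<in> S \<omega>})"
proof -
  have "mean_card M S = expectation (\<lambda>\<omega>. \<Sum>i\<in>UNIV. of_bool (i \<in> S \<omega>))"
    unfolding mean_card_def by (intro Bochner_Integration.integral_cong) simp_all
  also have "\<dots> = (\<Sum>i\<in>UNIV. expectation (\<lambda>\<omega>. of_bool (i \<in> S \<omega>)))"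
    by (intro Bochner_Integration.integral_sum integrable_finite_valued[OF assms]) simp
  finally show ?thesis by (simp only: expectation_of_bool_mem[OF assms])
qed

subsection \<open>One step of the method\<close>

lemma sum_ereal_less_infinity_iff:
  fixes a :: "'i \<Rightarrow> ereal"
  assumes "finite A" "\<And>i. i \<in> A \<Longrightarrow> a i \<noteq> -\<infinity>"
  shows "(\<Sum>i\<in>A. a i) \<noteq> -\<infinity>" "(\<Sum>i\<in>A. a i) < \<infinity> \<longleftrightarrow> (\<forall>i\<in>A. a i < \<infinity>)"
proof -
  show "(\<Sum>i\<in>A. a i) \<noteq> -\<infinity>"
    using assms by (induction A rule: finite_induct) auto
  show "(\<Sum>i\<in>A. a i) < \<infinity> \<longleftrightarrow> (\<forall>i\<in>A. a i < \<infinity>)"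
    using assms by (simp add: sum_Pinfty)
qed

text \<open>
  The sampling enters one step only through the weights \<open>p s\<close>, the probability that \<open>s\<close> is sampled,
  and \<open>\<alpha>\<close>, the probability that a given block is; \<open>xs\<close> is a minimizer of \<open>F\<close>.
\<close>

locale pcdm_problem =
  fixes blk :: "'m::finite \<Rightarrow> 'b::finite"
    and B :: "'b \<Rightarrow> real ^ 'm ^ 'm" and w :: "'b \<Rightarrow> real"
    and f :: "real ^ 'm \<Rightarrow> real" and f' :: "real ^ 'm \<Rightarrow> real ^ 'm"
    and \<psi> :: "'b \<Rightarrow> real ^ 'm \<Rightarrow> ereal" and F :: "real ^ 'm \<Rightarrow> ereal"
    and xs :: "real ^ 'm" and Fstar \<beta> \<mu>\<^sub>f \<mu>\<^sub>F \<alpha> :: real and p :: "'b set \<Rightarrow> real"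
  assumes posdef: "\<And>i. posdef_block blk i (B i)" and w_pos: "\<And>i. 0 < w i"
    and f_convex: "convex_on UNIV f" and f_smooth: "\<And>y. GDERIV f y :> f' y"
    and psi: "\<And>i. closed_convex_on (block_space blk i) (\<psi> i)"
    and F_def: "F = (\<lambda>y. ereal (f y) + block_sep blk \<psi> y)"
    and xs: "F xs = ereal Fstar" and Fstar_le: "\<And>y. ereal Fstar \<le> F y"
    and beta_pos: "0 < \<beta>"
    and f_param: "convexity_param (norm_w blk B w) (\<lambda>y. ereal (f y)) \<mu>\<^sub>f"
    and F_param: "convexity_param (norm_w blk B w) F \<mu>\<^sub>F" and muF_pos: "0 < \<mu>\<^sub>F"
    and p_nonneg: "\<And>s. 0 \<le> p s" and p_sum: "(\<Sum>s\<in>UNIV. p s) = 1"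
    and p_mem: "\<And>i. (\<Sum>s\<in>UNIV. p s * of_bool (i \<in> s)) = \<alpha>" and alpha_pos: "0 < \<alpha>"
    and eso: "\<And>x h. (\<Sum>s\<in>UNIV. p s * f (x + (\<Sum>i\<in>s. block blk i h)))
        \<le> f x + \<alpha> * (f' x \<bullet> h + \<beta> / 2 * (norm_w blk B w h)\<^sup>2)"
begin

abbreviation "N h \<equiv> (norm_w blk B w h)\<^sup>2"
abbreviation "model \<equiv> pcdm_model blk B f f' (block_sep blk \<psi>) \<beta> w"
abbreviation "\<phi> i y \<equiv> \<psi> i (block blk i y)"
text \<open>\<open>real_of_ereal\<close> sends infinite values to 0, so \<open>r\<close> and
  \<open>gap\<close> are used for points of \<open>edom F\<close>, where all the values are
  finite.\<close>

abbreviation "r i y \<equiv> real_of_ereal (\<phi> i y)"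
abbreviation "gap y \<equiv> real_of_ereal (F y) - Fstar"

text \<open>After exchanging the sums, each block carries the same total weight
  \<open>\<alpha>\<close> by \<open>p_mem\<close>; this is where uniformity of the sampling enters a
  step.\<close>

lemma weighted_sum:
  "(\<Sum>s\<in>UNIV. p s * (\<Sum>i\<in>s. c i)) = \<alpha> * (\<Sum>i\<in>UNIV. c i)"
proof -
  have "(\<Sum>s\<in>UNIV. p s * (\<Sum>i\<in>s. c i)) = (\<Sum>s\<in>UNIV. \<Sum>i\<in>UNIV. c i * (p s * of_bool (i \<in> s)))"
  proof (rule sum.cong[OF refl])
    fix s
    have "(\<Sum>i\<in>s. c i) = (\<Sum>i\<in>UNIV. c i * of_bool (i \<in> s))"
      by (intro sum.mono_neutral_cong_left) auto
    then have "p s * (\<Sum>i\<in>s. c i) = p s * (\<Sum>i\<in>UNIV. c i * of_bool (i \<in> s))" by (simp only:)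
    also have "\<dots> = (\<Sum>i\<in>UNIV. c i * (p s * of_bool (i \<in> s)))"
      by (simp only: sum_distrib_left mult.left_commute)
    finally show "p s * (\<Sum>i\<in>s. c i) = (\<Sum>i\<in>UNIV. c i * (p s * of_bool (i \<in> s)))" .
  qed
  also have "\<dots> = (\<Sum>i\<in>UNIV. c i * (\<Sum>s\<in>UNIV. p s * of_bool (i \<in> s)))"
    by (subst sum.swap) (simp only: sum_distrib_left)
  also have "\<dots> = \<alpha> * (\<Sum>i\<in>UNIV. c i)"
    unfolding p_mem by (simp add: sum_distrib_left mult.commute)
  finally show ?thesis .
qed

lemma weighted_const: "(\<Sum>s\<in>UNIV. p s * c) = c"
  by (simp add: p_sum flip: sum_distrib_right)

lemma psi_not_MInfty: "\<phi> i y \<noteq> -\<infinity>"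
  using psi[of i] by (simp add: closed_convex_on_def)

lemma closed_convex_Psi: "closed_convex_on UNIV (block_sep blk \<psi>)"
  unfolding block_sep_def
  by (intro closed_convex_on_sum closed_convex_on_compose_linear[OF psi]
      linear_conv_bounded_linear[THEN iffD1, OF linear_block]) simp_all

lemma closed_convex_F: "closed_convex_on UNIV F"
proof -
  have "continuous_on UNIV f"
    using f_smooth by (auto intro!: continuous_at_imp_continuous_on has_derivative_continuous
        simp: gderiv_def)
  then show ?thesis
    unfolding F_def by (intro closed_convex_on_add closed_convex_on_ereal f_convex closed_convex_Psi)
qed

lemma mem_edom_iff: "y \<in> edom F \<longleftrightarrow> (\<forall>i. \<phi> i y < \<infinity>)"
  and Psi_not_MInfty: "block_sep blk \<psi> y \<noteq> -\<infinity>"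
  using sum_ereal_less_infinity_iff[of UNIV "\<lambda>i. \<phi> i y", OF _ psi_not_MInfty]
  by (auto simp: edom_def F_def block_sep_def)

lemma Psi_eq: "y \<in> edom F \<Longrightarrow> block_sep blk \<psi> y = ereal (\<Sum>i\<in>UNIV. r i y)"
proof -
  assume "y \<in> edom F"
  then have "\<phi> i y = ereal (r i y)" for i
    using psi_not_MInfty[of i y] by (cases "\<phi> i y") (auto simp: mem_edom_iff)
  then show "block_sep blk \<psi> y = ereal (\<Sum>i\<in>UNIV. r i y)"
    unfolding block_sep_def by (subst sum_ereal[symmetric]) (rule sum.cong[OF refl])
qed

lemma F_eq: "y \<in> edom F \<Longrightarrow> F y = ereal (f y + (\<Sum>i\<in>UNIV. r i y))"
  by (simp add: F_def Psi_eq)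

lemma Psi_not_edom: "y \<notin> edom F \<Longrightarrow> block_sep blk \<psi> y = \<infinity>"
  using Psi_not_MInfty[of y] by (auto simp: edom_def F_def)

lemma xs_dom: "xs \<in> edom F"
  by (simp add: edom_def xs)

lemma gap_nonneg: "y \<in> edom F \<Longrightarrow> 0 \<le> gap y"
  using Fstar_le[of y] by (simp add: F_eq)

text \<open>
  Averaging the strong convexity of \<open>f\<close> over the sampling gives the lower bound matching ESO.
\<close>

lemma muf_le_beta: "\<mu>\<^sub>f \<le> \<beta>"
proof -
  \<comment> \<open>Any nonzero direction serves; this is the all-ones vector.\<close>
  define h :: "real ^ 'm" where "h = 1"
  let ?h = "\<lambda>s. \<Sum>i\<in>s. block blk i h"
  have h: "h \<noteq> 0" by (simp add: h_def vec_eq_iff)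
  have N: "0 < N h" using norm_w_sq_pos[OF posdef w_pos h] .
  have Nsum: "N h = (\<Sum>i\<in>UNIV. w i * ((B i *v block blk i h) \<bullet> block blk i h))"
    by (simp add: norm_w_sq[OF posdef w_pos] w_form_def)
  have "f 0 + \<alpha> * (f' 0 \<bullet> h) + \<mu>\<^sub>f / 2 * (\<alpha> * N h)
      = (\<Sum>s\<in>UNIV. p s * f 0) + (\<Sum>s\<in>UNIV. p s * (\<Sum>i\<in>s. f' 0 \<bullet> block blk i h))
        + \<mu>\<^sub>f / 2 * (\<Sum>s\<in>UNIV. p s * N (?h s))"
    unfolding norm_w_sum_block_sq[OF posdef w_pos] weighted_sum weighted_const Nsum
    by (simp add: sum_block flip: inner_sum_right)
  also have "\<dots> = (\<Sum>s\<in>UNIV. p s * (f 0 + f' 0 \<bullet> (?h s - 0) + \<mu>\<^sub>f / 2 * N (?h s - 0)))"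
    by (simp add: inner_sum_right sum_distrib_left sum.distrib distrib_left mult.left_commute)
  also have "\<dots> \<le> (\<Sum>s\<in>UNIV. p s * f (?h s))"
    by (intro sum_mono mult_left_mono p_nonneg convexity_param_gradient[OF f_convex f_smooth f_param])
  also have "\<dots> \<le> f 0 + \<alpha> * (f' 0 \<bullet> h + \<beta> / 2 * N h)"
    using eso[of 0 h] by simp
  finally have "(\<alpha> * N h) * \<mu>\<^sub>f \<le> (\<alpha> * N h) * \<beta>" by (simp add: algebra_simps)
  then show ?thesis using N alpha_pos by (simp add: mult_le_cancel_left_pos)
qed

definition rate :: real where "rate = \<mu>\<^sub>F / (\<beta> + \<mu>\<^sub>F - \<mu>\<^sub>f)"

text \<open>By \<open>muf_le_beta\<close> the denominator is at least the numerator, so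
  \<open>rate\<close> can serve as a convex weight.\<close>

lemma rate_bounds: "0 < rate" "rate \<le> 1"
  using muf_le_beta muF_pos by (auto simp: rate_def)

lemma model_eq: "v + h \<in> edom F \<Longrightarrow>
    model v h = ereal (f v + f' v \<bullet> h + \<beta> / 2 * N h + (\<Sum>i\<in>UNIV. r i (v + h)))"
  by (simp add: pcdm_model_def Psi_eq)

text \<open>The step \<open>xs - v\<close> has finite model value, so no minimizer can have an
  infinite one.\<close>

lemma arg_min_dom:
  assumes "is_arg_min (model v) (\<lambda>_. True) h"
  shows "v + h \<in> edom F"
proof (rule ccontr)
  assume "v + h \<notin> edom F"
  then have "model v h = \<infinity>" by (simp add: pcdm_model_def Psi_not_edom)
  moreover have "model v (xs - v) < \<infinity>" using xs_dom by (simp add: model_eq)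
  ultimately show False using assms by (auto simp: is_arg_min_def)
qed

text \<open>At the midpoint of two distinct minimizers the quadratic term falls below its average by
  \<open>d / 8\<close>, while \<Psi> does not exceed its average, so the midpoint would be strictly
  better.\<close>

lemma arg_min_unique:
  assumes "is_arg_min (model v) (\<lambda>_. True) h1" "is_arg_min (model v) (\<lambda>_. True) h2"
  shows "h1 = h2"
proof (rule ccontr)
  assume "h1 \<noteq> h2"
  define d where "d = \<beta> * N (h1 - h2)"
  have d: "0 < d"
    using beta_pos norm_w_sq_pos[OF posdef w_pos, of "h1 - h2"] \<open>h1 \<noteq> h2\<close> by (simp add: d_def)
  define h where "h = (1 / 2) *\<^sub>R (h1 + h2)"
  define Q where "Q u = f v + f' v \<bullet> u + \<beta> / 2 * N u" for u
  define R where "R u = (\<Sum>i\<in>UNIV. r i (v + u))" for u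
  have model: "model v u = ereal (Q u + R u)" if "v + u \<in> edom F" for u
    using model_eq[OF that] by (simp add: Q_def R_def)
  have dom: "v + h1 \<in> edom F" "v + h2 \<in> edom F" using assms by (auto intro: arg_min_dom)
  have eq: "model v h1 = model v h2"
    using assms by (intro antisym) (auto simp: is_arg_min_def not_less)
  have "block_sep blk \<psi> ((1 - 1 / 2) *\<^sub>R (v + h1) + (1 / 2) *\<^sub>R (v + h2))
      \<le> ereal ((1 - 1 / 2) * R h1 + 1 / 2 * R h2)"
    unfolding R_def using dom by (intro closed_convex_on_convexD closed_convex_Psi Psi_eq) auto
  moreover have "(1 - 1 / 2) *\<^sub>R (v + h1) + (1 / 2) *\<^sub>R (v + h2) = v + h"
    by (simp add: h_def vec_eq_iff field_simps)
  ultimately have Psi: "block_sep blk \<psi> (v + h) \<le> ereal ((R h1 + R h2) / 2)"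
    by (simp add: field_simps)
  then have dom': "v + h \<in> edom F" by (auto simp: edom_def F_def)
  have "R h \<le> (R h1 + R h2) / 2" using Psi by (simp add: Psi_eq[OF dom'] R_def)
  moreover have "Q h = (Q h1 + Q h2) / 2 - d / 8"
    unfolding Q_def h_def d_def norm_w_midpoint_sq[OF posdef w_pos]
    by (simp add: inner_add_right field_simps)
  moreover have "\<not> model v h < model v h1" using assms(1) by (simp add: is_arg_min_def)
  then have "Q h1 + R h1 \<le> Q h + R h" by (simp add: model dom dom')
  moreover have "Q h1 + R h1 = Q h2 + R h2" using eq by (simp add: model dom)
  ultimately show False using d by argo
qed

text \<open>
  The arg min is compared with \<open>rate *\<^sub>R (xs - v)\<close>; \<open>rate\<close> is chosen so that the two quadratic terms
  cancel (equation \<open>bal\<close>).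
\<close>

lemma model_arg_min_le:
  assumes v: "v \<in> edom F" and h: "is_arg_min (model v) (\<lambda>_. True) h"
  shows "f v + f' v \<bullet> h + \<beta> / 2 * N h + (\<Sum>i\<in>UNIV. r i (v + h)) - Fstar \<le> (1 - rate) * gap v"
proof -
  define z where "z = (1 - rate) *\<^sub>R v + rate *\<^sub>R xs"
  define q where "q = N (xs - v)"
  have zv: "z - v = rate *\<^sub>R (xs - v)" by (simp add: z_def algebra_simps)
  have "F v = ereal (real_of_ereal (F v))" using v by (simp add: F_eq)
  from strong_convexity_segment[OF closed_convex_F Fstar_le F_param
      continuous_norm_w[OF posdef w_pos] norm_w_scaleR_sq[OF posdef w_pos] this xs, of rate]
  have Fz: "F z \<le> ereal ((1 - rate) * real_of_ereal (F v) + rate * Fstar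
      - \<mu>\<^sub>F / 2 * (rate * (1 - rate) * q))"
    using rate_bounds by (simp add: z_def q_def)
  then have z: "z \<in> edom F" by (auto simp: edom_def)
  have Nz: "N (z - v) = rate\<^sup>2 * q" unfolding zv q_def by (rule norm_w_scaleR_sq[OF posdef w_pos])
  have bal: "(\<beta> - \<mu>\<^sub>f) * rate = \<mu>\<^sub>F * (1 - rate)"
    using muf_le_beta muF_pos by (simp add: rate_def field_simps)
  have "\<not> model v (z - v) < model v h" using h by (simp add: is_arg_min_def)
  then have "f v + f' v \<bullet> h + \<beta> / 2 * N h + (\<Sum>i\<in>UNIV. r i (v + h))
      \<le> f v + f' v \<bullet> (z - v) + \<beta> / 2 * N (z - v) + (\<Sum>i\<in>UNIV. r i z)"
    using z arg_min_dom[OF h] by (simp add: model_eq)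
  \<comment> \<open>Strong convexity of \<open>f\<close> at \<open>v\<close> turns the linear model
    into \<open>f z\<close> and absorbs the part \<open>\<mu>\<^sub>f\<close> of the coefficient
    \<open>\<beta>\<close>.\<close>
  also have "\<dots> \<le> f z + (\<Sum>i\<in>UNIV. r i z) + (\<beta> - \<mu>\<^sub>f) / 2 * N (z - v)"
    using convexity_param_gradient[OF f_convex f_smooth f_param, of v z] by (simp add: field_simps)
  also have "\<dots> \<le> (1 - rate) * real_of_ereal (F v) + rate * Fstar
      - \<mu>\<^sub>F / 2 * (rate * (1 - rate) * q) + (\<beta> - \<mu>\<^sub>f) / 2 * N (z - v)"
    using Fz F_eq[OF z] by simp
  also have "(\<beta> - \<mu>\<^sub>f) / 2 * N (z - v) = rate * q / 2 * ((\<beta> - \<mu>\<^sub>f) * rate)"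
    unfolding Nz by (simp add: power2_eq_square)
  also have "\<dots> = \<mu>\<^sub>F / 2 * (rate * (1 - rate) * q)"
    unfolding bal by simp
  finally show ?thesis by (simp add: algebra_simps)
qed

lemma pcdm_step:
  assumes v: "v \<in> edom F" and h: "is_arg_min (model v) (\<lambda>_. True) h"
  shows "v + (\<Sum>i\<in>s. block blk i h) \<in> edom F"
    and "(\<Sum>s\<in>UNIV. p s * gap (v + (\<Sum>i\<in>s. block blk i h))) \<le> (1 - \<alpha> * rate) * gap v"
proof -
  let ?h = "\<lambda>s. \<Sum>i\<in>s. block blk i h"
  have blk: "block blk i (v + ?h s) = (if i \<in> s then block blk i (v + h) else block blk i v)" for i s
    by (simp add: linear_add[OF linear_block] block_sum_block)
  have vh: "v + h \<in> edom F" by (rule arg_min_dom[OF h])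
  \<comment> \<open>The domain is a product over blocks, and each block of the new point is taken
    from \<open>v\<close> or from \<open>v + h\<close>.\<close>
  show dom: "v + ?h s \<in> edom F" for s
    using v vh by (simp add: mem_edom_iff blk)
  \<comment> \<open>Separability writes the change of \<Psi> as a sum over the sampled blocks, so
    \<open>weighted_sum\<close> computes its average exactly.\<close>
  have R: "(\<Sum>i\<in>UNIV. r i (v + ?h s)) = (\<Sum>i\<in>UNIV. r i v) + (\<Sum>i\<in>s. r i (v + h) - r i v)" for s
  proof -
    have "(\<Sum>i\<in>s. r i (v + h) - r i v) = (\<Sum>i\<in>UNIV. if i \<in> s then r i (v + h) - r i v else 0)"
      by (simp add: sum.If_cases)
    then show ?thesis
      by (simp add: blk flip: sum.distrib) (rule sum.cong, auto)
  qed
  have "(\<Sum>s\<in>UNIV. p s * gap (v + ?h s))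
      = (\<Sum>s\<in>UNIV. p s * f (v + ?h s)) + (\<Sum>s\<in>UNIV. p s * ((\<Sum>i\<in>UNIV. r i v) - Fstar))
        + (\<Sum>s\<in>UNIV. p s * (\<Sum>i\<in>s. r i (v + h) - r i v))"
    unfolding F_eq[OF dom] R by (simp add: sum.distrib[symmetric] algebra_simps)
  also have "\<dots> \<le> f v + \<alpha> * (f' v \<bullet> h + \<beta> / 2 * N h) + ((\<Sum>i\<in>UNIV. r i v) - Fstar)
      + \<alpha> * (\<Sum>i\<in>UNIV. r i (v + h) - r i v)"
    unfolding weighted_sum weighted_const using eso[of v h] by simp
  also have "\<dots> = (1 - \<alpha>) * gap v
      + \<alpha> * (f v + f' v \<bullet> h + \<beta> / 2 * N h + (\<Sum>i\<in>UNIV. r i (v + h)) - Fstar)"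
    by (simp add: F_eq[OF v] sum_subtractf algebra_simps)
  also have "\<dots> \<le> (1 - \<alpha>) * gap v + \<alpha> * ((1 - rate) * gap v)"
    using model_arg_min_le[OF v h] alpha_pos by simp
  finally show "(\<Sum>s\<in>UNIV. p s * gap (v + ?h s)) \<le> (1 - \<alpha> * rate) * gap v"
    by (simp add: algebra_simps)
qed

end

subsection \<open>The high-probability bound\<close>

theorem theorem11:
  fixes blk :: "'m::finite \<Rightarrow> 'b::finite"
    and B :: "'b \<Rightarrow> real ^ 'm ^ 'm"
    and w :: "'b \<Rightarrow> real"
    and f :: "real ^ 'm \<Rightarrow> real"
    and f' :: "real ^ 'm \<Rightarrow> real ^ 'm"
    and \<psi> :: "'b \<Rightarrow> real ^ 'm \<Rightarrow> ereal"
    and \<Psi> F :: "real ^ 'm \<Rightarrow> ereal"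
    and Fstar \<beta> \<mu>\<^sub>f \<mu>\<^sub>F \<rho> \<epsilon> :: real
    and M :: "'a measure"
    and S :: "nat \<Rightarrow> 'a \<Rightarrow> 'b set"
    and x\<^sub>0 :: "real ^ 'm"
    and x :: "nat \<Rightarrow> 'a \<Rightarrow> real ^ 'm"
    and K :: nat
  assumes B_posdef: "\<And>i. posdef_block blk i (B i)"
    and f_convex: "convex_on UNIV f"
    and f_smooth: "\<And>y. GDERIV f y :> f' y"
    and psi_closed_convex: "\<And>i. closed_convex_on (block_space blk i) (\<psi> i)"
    and Psi_def: "\<Psi> = block_sep blk \<psi>"
    and F_def: "F = (\<lambda>y. ereal (f y) + \<Psi> y)"
    and Fstar_attained: "\<exists>y. F y = ereal Fstar"
    and Fstar_le: "\<And>y. ereal Fstar \<le> F y"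
    and prob_space: "prob_space M"
    and S_indep: "prob_space.indep_vars M (\<lambda>_. count_space UNIV) S UNIV"
    and S_ident: "\<And>k. distr M (count_space UNIV) (S k) = distr M (count_space UNIV) (S 0)"
    and S_uniform: "\<And>k. uniform_sampling M (S k)"
    and S_proper: "\<And>k. proper_sampling M (S k)"
    and beta_pos: "0 < \<beta>"
    and w_pos: "\<And>i. 0 < w i"
    and eso: "ESO blk B f f' M (S 0) \<beta> w"
    and f_param: "convexity_param (norm_w blk B w) (\<lambda>y. ereal (f y)) \<mu>\<^sub>f"
    and F_param: "convexity_param (norm_w blk B w) F \<mu>\<^sub>F"
    and muF_pos: "0 < \<mu>\<^sub>F"
    and x0_dom: "x\<^sub>0 \<in> edom F"
    and rho: "0 < \<rho>" "\<rho> < 1"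
    and eps: "0 < \<epsilon>" "\<epsilon> < real_of_ereal (F x\<^sub>0) - Fstar"
    and K_ge: "real K \<ge> real CARD('b) / mean_card M (S 0)
                 * ((\<beta> + \<mu>\<^sub>F - \<mu>\<^sub>f) / \<mu>\<^sub>F)
                 * ln ((real_of_ereal (F x\<^sub>0) - Fstar) / (\<epsilon> * \<rho>))"
    and pcdm: "\<And>\<omega>. \<omega> \<in> space M \<Longrightarrow>
                 pcdm_run blk B f f' \<Psi> \<beta> w (\<lambda>k. S k \<omega>) x\<^sub>0 (\<lambda>k. x k \<omega>)"
  shows "measure M {\<omega> \<in> space M. F (x K \<omega>) - ereal Fstar \<le> ereal \<epsilon>} \<ge> 1 - \<rho>"
  proof -

  \<comment> \<open>Sampling weights and reduction to the one-step setting\<close>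
  interpret prob_space M by (rule prob_space)
  obtain xs where xs: "F xs = ereal Fstar" using Fstar_attained by blast
  define p where "p s = prob {\<omega> \<in> space M. S 0 \<omega> = s}" for s
  define \<alpha> where "\<alpha> = mean_card M (S 0) / real CARD('b)"
  have S: "S k \<in> measurable M (count_space UNIV)" for k
    using S_uniform[of k] by (simp add: uniform_sampling_def sampling_def)
  have exp_S: "(LINT \<omega>|M. g (S 0 \<omega>)) = (\<Sum>s\<in>UNIV. p s * g s)" for g :: "'b set \<Rightarrow> real"
    unfolding p_def by (rule expectation_finite_type[OF S])
  \<comment> \<open>Identical distribution gives every \<open>S k\<close> the weights of
    \<open>S 0\<close>, so one instance of the locale covers all steps.\<close>
  have p_S: "prob {\<omega> \<in> space M. S k \<omega> = s} = p s" for k s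
  proof -
    have "prob {\<omega> \<in> space M. S k \<omega> = s} = measure (distr M (count_space UNIV) (S k)) {s}" for k
      by (subst measure_distr[OF S]) (simp_all add: vimage_def Int_def conj_commute)
    then show ?thesis unfolding p_def by (simp only: S_ident[of k])
  qed
  \<comment> \<open>By uniformity the inclusion probabilities of all blocks agree, and they add up
    to the mean cardinality.\<close>
  have mem_prob: "prob {\<omega> \<in> space M. i \<in> S 0 \<omega>} = \<alpha>" for i
  proof -
    have "prob {\<omega> \<in> space M. j \<in> S 0 \<omega>} = prob {\<omega> \<in> space M. i \<in> S 0 \<omega>}" for j
      using S_uniform[of 0] by (simp add: uniform_sampling_def)
    then have "mean_card M (S 0) = (\<Sum>j\<in>(UNIV :: 'b set). prob {\<omega> \<in> space M. i \<in> S 0 \<omega>})"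
      unfolding mean_card_eq_sum[OF S] by (intro sum.cong refl)
    then show ?thesis by (simp add: \<alpha>_def)
  qed
  interpret pcdm_problem blk B w f f' \<psi> F xs Fstar \<beta> \<mu>\<^sub>f \<mu>\<^sub>F \<alpha> p
  proof
    show "(\<Sum>s\<in>UNIV. p s) = 1" using exp_S[of "\<lambda>_. 1"] by (simp add: prob_space)
    show "(\<Sum>s\<in>UNIV. p s * of_bool (i \<in> s)) = \<alpha>" for i
      using exp_S[of "\<lambda>s. of_bool (i \<in> s)"] expectation_of_bool_mem[OF S[of 0], of i] mem_prob[of i] by (simp only:)
    show "0 < \<alpha>" using S_proper[of 0] mem_prob by (simp add: proper_sampling_def)
    show "(\<Sum>s\<in>UNIV. p s * f (y + (\<Sum>i\<in>s. block blk i h)))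
        \<le> f y + \<alpha> * (f' y \<bullet> h + \<beta> / 2 * (norm_w blk B w h)\<^sup>2)" for y h
      unfolding exp_S[of "\<lambda>s. f (y + (\<Sum>i\<in>s. block blk i h))", symmetric]
      using eso by (simp only: ESO_def \<alpha>_def)
    show "F = (\<lambda>y. ereal (f y) + block_sep blk \<psi> y)" by (simp add: F_def Psi_def)
    show "0 \<le> p s" for s by (simp add: p_def)
  qed (fact B_posdef w_pos f_convex f_smooth psi_closed_convex xs Fstar_le beta_pos f_param F_param
      muF_pos)+
  let ?am = "\<lambda>v. is_arg_min (model v) (\<lambda>_. True)"
  \<comment> \<open>The arg min is unique, so a run is a fixed function of the sampled sets.\<close>
  define step where "step v s = v + (\<Sum>i\<in>s. block blk i (SOME h. ?am v h))" for v s
  have run: "x 0 \<omega> = x\<^sub>0" "?am (x k \<omega>) (SOME h. ?am (x k \<omega>) h)"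
    "x (Suc k) \<omega> = step (x k \<omega>) (S k \<omega>)" if \<omega>: "\<omega> \<in> space M" for \<omega> k
  proof -
    show "x 0 \<omega> = x\<^sub>0" using pcdm[OF \<omega>] by (simp add: pcdm_run_def)
    obtain h where h: "?am (x k \<omega>) h" "x (Suc k) \<omega> = x k \<omega> + (\<Sum>i\<in>S k \<omega>. block blk i h)"
      using pcdm[OF \<omega>] unfolding pcdm_run_def Psi_def by blast
    from h(1) show am: "?am (x k \<omega>) (SOME h. ?am (x k \<omega>) h)" by (rule someI)
    have "(SOME h. ?am (x k \<omega>) h) = h" by (rule arg_min_unique[OF am h(1)])
    with h(2) show "x (Suc k) \<omega> = step (x k \<omega>) (S k \<omega>)" by (simp add: step_def)
  qed
  have dom: "x k \<omega> \<in> edom F" if "\<omega> \<in> space M" for \<omega> k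
  proof (induction k)
    case 0
    then show ?case using run(1)[OF that] x0_dom by simp
  next
    case (Suc k)
    then show ?case
      unfolding run(3)[OF that] step_def by (rule pcdm_step(1)[OF _ run(2)[OF that]])
  qed
  define c where "c = 1 - \<alpha> * rate"
  have alpha_le: "\<alpha> \<le> 1" using mem_prob prob_le_1 by metis
  have ar: "0 < \<alpha> * rate" using rate_bounds alpha_pos by simp
  \<comment> \<open>Nonnegativity is needed both to iterate the contraction and to compare
    \<open>c ^ K\<close> with a power of the exponential.\<close>
  have c: "0 \<le> c"
    using mult_mono[OF alpha_le rate_bounds(2)] rate_bounds(1) alpha_pos by (simp add: c_def)
  have contr: "(\<Sum>s\<in>UNIV. prob {\<omega> \<in> space M. S k \<omega> = s} * gap (step (x k \<omega>) s)) \<le> c * gap (x k \<omega>)"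
    if "\<omega> \<in> space M" for \<omega> k
    unfolding p_S step_def c_def by (rule pcdm_step(2)[OF dom[OF that] run(2)[OF that]])
  note E = expectation_contraction[where x = x and g = gap and step = step, OF S_indep run(1) run(3) contr c]

  \<comment> \<open>From the contraction to the probability bound\<close>
  let ?G = "gap x\<^sub>0"
  have G: "0 < ?G" using eps by simp
  have "ln (?G / (\<epsilon> * \<rho>)) \<le> real K * (\<alpha> * rate)"
  proof -
    \<comment> \<open>The factor in front of the logarithm in the bound on \<open>K\<close> is
      exactly the reciprocal of the contraction gain \<open>\<alpha> * rate\<close>.\<close>
    have "real CARD('b) / mean_card M (S 0) * ((\<beta> + \<mu>\<^sub>F - \<mu>\<^sub>f) / \<mu>\<^sub>F) = 1 / (\<alpha> * rate)"
      by (simp add: \<alpha>_def rate_def)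
    then have "1 / (\<alpha> * rate) * ln (?G / (\<epsilon> * \<rho>)) \<le> real K" using K_ge by (simp only:)
    then show ?thesis using ar by (simp add: field_simps)
  qed
  then have exp_le: "exp (real K * - (\<alpha> * rate)) \<le> exp (- ln (?G / (\<epsilon> * \<rho>)))" by simp
  have "c ^ K \<le> exp (- (\<alpha> * rate)) ^ K"
    using exp_ge_add_one_self[of "- (\<alpha> * rate)"] c by (intro power_mono) (simp_all add: c_def)
  also have "\<dots> = exp (real K * - (\<alpha> * rate))" by (rule exp_of_nat_mult[symmetric])
  also note exp_le
  also have "exp (- ln (?G / (\<epsilon> * \<rho>))) = \<epsilon> * \<rho> / ?G" using G eps rho by (simp add: exp_minus)
  finally have "c ^ K \<le> \<epsilon> * \<rho> / ?G" .
  then have cK: "c ^ K * ?G \<le> \<epsilon> * \<rho>" using G by (simp add: field_simps)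
  have meas: "(\<lambda>\<omega>. gap (x K \<omega>)) \<in> borel_measurable M" using E(1) by (rule borel_measurable_integrable)
  have "prob {\<omega> \<in> space M. \<epsilon> \<le> gap (x K \<omega>)} \<le> expectation (\<lambda>\<omega>. gap (x K \<omega>)) / \<epsilon>"
    using E(1) gap_nonneg[OF dom] eps
    by (intro integral_Markov_inequality_measure[where A = "space M"]) auto
  also have "\<dots> \<le> \<rho>"
    using order_trans[OF E(2) cK] eps by (simp add: field_simps)
  finally have bad: "prob {\<omega> \<in> space M. \<epsilon> \<le> gap (x K \<omega>)} \<le> \<rho>" .
  \<comment> \<open>The iterates stay in the domain, so the extended-real inequality is one between
    reals. Markov controls \<open>\<epsilon> \<le> gap\<close>, whose complement
    \<open>gap < \<epsilon>\<close> lies in this event.\<close>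
  have good: "{\<omega> \<in> space M. F (x K \<omega>) - ereal Fstar \<le> ereal \<epsilon>}
      = {\<omega> \<in> space M. gap (x K \<omega>) \<le> \<epsilon>}"
    using dom[of _ K] by (auto simp: F_eq)
  have "1 - \<rho> \<le> 1 - prob {\<omega> \<in> space M. \<epsilon> \<le> gap (x K \<omega>)}" using bad by simp
  also have "\<dots> = prob (space M - {\<omega> \<in> space M. \<epsilon> \<le> gap (x K \<omega>)})"
    using meas by (subst prob_compl) auto
  also have "\<dots> \<le> prob {\<omega> \<in> space M. gap (x K \<omega>) \<le> \<epsilon>}"
    using meas by (intro finite_measure_mono) auto
  finally show ?thesis unfolding good .
qed

end
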